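(* For the even-signed permutation group $D_n$: (1) $\displaystyle\sum_{\pi\in D_n}(-1)^{\ell_D(\pi)}q^{\ell_D(\pi)}=[n]_{-q}\prod_{k=1}^{n-1}[2k]_{-q}$; (2) $\displaystyle\sum_{\pi\in D_n}(-1)^{\ell_D(\pi)}q^{\mathrm{dmaj}(\pi)}=[n]_{(-1)^{n-1}q}\prod_{k=1}^{n-1}[2]_{(-q)^k}[k]_{(-1)^{k-1}q}$.
   Context: For an integer $m\ge 0$ and any quantity $p$, $[m]_p:=1+p+\cdots+p^{m-1}$. $B_n$ is the group of signed permutations: bijections $\pi$ of $\{\pm1,\dots,\pm n\}$ with $\pi(-i)=-\pi(i)$, written $\pi=\pi_1\cdots\pi_n$ with $\pi_i=\pi(i)$. Put $\mathrm{Neg}(\pi):=\{i\in\{1,\dots,n\}:\pi_i<0\}$ and $\mathrm{neg}(\pi):=|\mathrm{Neg}(\pi)|$. $D_n:=\{\pi\in B_n:\mathrm{neg}(\pi)\text{ is even}\}$. With respect to the usual order of the integers, $\mathrm{inv}(\pi):=|\{(i,j):1\le i<j\le n,\ \pi_i>\pi_j\}|$ and $\mathrm{maj}(\pi):=\sum_{1\le i\le n-1,\ \pi_i>\pi_{i+1}} i$. $\ell_D$ is the Coxeter length function of $D_n$ with respect to the generators $s_0'=(\bar 1,2)$ (exchanging $-1$ with $2$ and $1$ with $-2$) and $s_i=(i,i+1)$, $1\le i\le n-1$; it satisfies $\ell_D(\pi)=\mathrm{inv}(\pi)-\mathrm{neg}(\pi)-\sum_{i\in\mathrm{Neg}(\pi)}\pi_i$.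 Finally $\mathrm{dmaj}(\pi):=\mathrm{maj}(\pi)-\mathrm{neg}(\pi)-\sum_{i\in\mathrm{Neg}(\pi)}\pi_i$. *)

theory Defs
  imports Complex_Main "HOL-Combinatorics.Permutations"
begin

definition qnum :: "nat \<Rightarrow> 'a::comm_ring_1 \<Rightarrow> 'a" where
  "qnum m p = (\<Sum>i<m. p ^ i)"

text \<open>
  Signed permutations are functions on \<^typ>\<open>int\<close> that permute the set of all nonzero integers of
  absolute value at most \<open>n\<close>. Being the identity outside this set, each of them is represented
  by exactly one function, and the group operation is composition.
\<close>

definition signed_perms :: "nat \<Rightarrow> (int \<Rightarrow> int) set" where
  "signed_perms n = {\<pi>. \<pi> permutes ({- int n..int n} - {0}) \<and> (\<forall>i. \<pi> (- i) = - \<pi> i)}"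

definition Neg :: "nat \<Rightarrow> (int \<Rightarrow> int) \<Rightarrow> int set" where
  "Neg n \<pi> = {i \<in> {1..int n}. \<pi> i < 0}"

definition neg :: "nat \<Rightarrow> (int \<Rightarrow> int) \<Rightarrow> nat" where
  "neg n \<pi> = card (Neg n \<pi>)"

definition even_signed_perms :: "nat \<Rightarrow> (int \<Rightarrow> int) set" where
  "even_signed_perms n = {\<pi> \<in> signed_perms n. even (neg n \<pi>)}"

definition maj :: "nat \<Rightarrow> (int \<Rightarrow> int) \<Rightarrow> int" where
  "maj n \<pi> = (\<Sum>i \<in> {i \<in> {1..int n - 1}. \<pi> i > \<pi> (i + 1)}. i)"

definition dmaj :: "nat \<Rightarrow> (int \<Rightarrow> int) \<Rightarrow> int" where
  "dmaj n \<pi> = maj n \<pi> - int (neg n \<pi>) - (\<Sum>i \<in> Neg n \<pi>. \<pi> i)"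

definition simple_refl :: "int \<Rightarrow> int \<Rightarrow> int" where
  "simple_refl i = transpose i (i + 1) \<circ> transpose (- i) (- (i + 1))"

definition simple_refl0 :: "int \<Rightarrow> int" where
  "simple_refl0 = transpose (- 1) 2 \<circ> transpose 1 (- 2)"

text \<open>
  The generator \<^const>\<open>simple_refl0\<close> moves \<open>2\<close>, so it is present only for \<open>n \<ge> 2\<close>;
  the group for \<open>n = 1\<close> is trivial and has no generators.
\<close>

definition D_generators :: "nat \<Rightarrow> (int \<Rightarrow> int) set" where
  "D_generators n = simple_refl ` {1..int n - 1} \<union> (if n \<ge> 2 then {simple_refl0} else {})"

definition word_length :: "('a \<Rightarrow> 'a) set \<Rightarrow> ('a \<Rightarrow> 'a) \<Rightarrow> nat" where
  "word_length S g = (LEAST k. \<exists>ws. length ws = k \<and> set ws \<subseteq> S \<and> foldr (\<circ>) ws id = g)"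

definition length_D :: "nat \<Rightarrow> (int \<Rightarrow> int) \<Rightarrow> nat" where
  "length_D n \<pi> = word_length (D_generators n) \<pi>"

text \<open>
  \<^const>\<open>dmaj\<close> is never negative, so \<^const>\<open>nat\<close> loses nothing when it is used as an exponent.
\<close>

lemma dmaj_nonneg: "dmaj n \<pi> \<ge> 0"
proof -
  have "(\<Sum>i \<in> Neg n \<pi>. \<pi> i) \<le> (\<Sum>i \<in> Neg n \<pi>. - 1)"
    by (rule sum_mono) (auto simp: Neg_def)
  moreover have "maj n \<pi> \<ge> 0"
    unfolding maj_def by (rule sum_nonneg) auto
  ultimately show ?thesis
    by (simp add: dmaj_def neg_def)
qed

end

theory Submission
  imports Defs "HOL-Combinatorics.Multiset_Permutations"
begin

text \<open>
  Both identities factor through the cosets of the symmetric group. A signed permutation is given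
  by the set \<open>A\<close> of absolute values of its negative entries, followed by an arbitrary arrangement of
  the resulting \<open>n\<close> integers. Inversions and descents see only the arrangement. The remaining part
  of both statistics, \<open>- neg - (\<Sum>i\<in>Neg. \<pi> i)\<close>, equals \<open>\<Sum>a\<in>A. a - 1\<close> and sees only \<open>A\<close>. Hence,
  with \<open>x = - q\<close>, each sum is the product of \<open>\<Sum>A. x ^ (\<Sum>a\<in>A. a - 1)\<close> over the even subsets \<open>A\<close> of
  \<open>{1..n}\<close> with a sum over the arrangements of \<open>n\<close> letters (\<open>sum_even_signed_perms_by_values\<close>). The
  first factor is \<open>\<Prod>k=1..n-1. 1 + x ^ k\<close>, because the element \<open>1\<close> has weight one and serves to
  correct the parity (\<open>sum_Pow_by_parity\<close>).

  For the length, the sum over arrangements is the classical \<open>\<Prod>k=1..n. qnum k x\<close>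
  (\<open>sum_power_inversions\<close>), and the two products combine since \<open>qnum k x * (1 + x ^ k) = qnum (2 * k) x\<close>.
  For the major index it is the Gessel--Simion formula for the sum of \<open>(- 1) ^ inv * q ^ maj\<close>
  (\<open>sum_signed_major\<close>). It is proved by induction in a refined form that prescribes the last letter:
  with \<open>t = (- 1) ^ (n - 1) * q\<close>, the words whose last letter is smaller than exactly \<open>r\<close> others
  account for the term \<open>t ^ r\<close> of the factor \<open>qnum n t\<close> (\<open>sum_signed_major_last\<close>).

  That the word length really is \<open>inv + (\<Sum>a\<in>A. a - 1)\<close> (\<open>length_D_eq\<close>) follows by counting the
  positive roots made negative. Each generator changes their number by exactly one, every element
  other than the identity admits a generator that lowers it, and the count of roots is matched with
  the formula in \<open>card_root_inversions\<close>.
\<close>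

section \<open>Sums over rearrangements of a set\<close>

lemma qnum_Suc: "qnum (Suc m) p = qnum m p + p ^ m"
  by (simp add: qnum_def)

lemma qnum_add: "qnum (a + b) p = qnum a p + p ^ a * qnum b p"
  by (induction b) (simp_all add: qnum_def power_add algebra_simps)

lemma qnum_double: "qnum k p * (1 + p ^ k) = qnum (2 * k) p"
  unfolding mult_2 qnum_add by (simp add: algebra_simps)

text \<open>
  Lists are read from right to left: the head \<open>v\<close> of \<open>v # ys\<close> is the last letter of the word. Every
  induction below strips the last letter of a word, and the last letter is what determines how
  both statistics grow: it creates one inversion with each larger letter before it, and possibly
  one descent, at the position just before it.
\<close>

fun inversions :: "'b::linorder list \<Rightarrow> nat" where
  "inversions [] = 0"
| "inversions (v # ys) = card {u \<in> set ys. v < u} + inversions ys"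

fun major :: "'b::linorder list \<Rightarrow> nat" where
  "major [] = 0"
| "major [v] = 0"
| "major (v # w # ys) = (if v < w then Suc (length ys) else 0) + major (w # ys)"

definition num_above :: "'b::linorder set \<Rightarrow> 'b \<Rightarrow> nat" where
  "num_above V v = card {u \<in> V. v < u}"

text \<open>
  The numbers of larger elements are \<open>0, \<dots>, card V - 1\<close>, each occurring once.
\<close>

lemma sum_power_num_above:
  fixes V :: "'b::linorder set"
  assumes "finite V"
  shows "(\<Sum>v\<in>V. p ^ num_above V v) = qnum (card V) p"
  using assms
proof (induction rule: finite_linorder_min_induct)
  case empty
  then show ?case by (simp add: qnum_def)
next
  case (insert b A)
  have "{u \<in> insert b A. b < u} = A" using insert by auto
  then have b: "num_above (insert b A) b = card A" by (simp add: num_above_def)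
  have A: "num_above (insert b A) v = num_above A v" if "v \<in> A" for v
  proof -
    have "{u \<in> insert b A. v < u} = {u \<in> A. v < u}" using insert.hyps(2) that by force
    then show ?thesis by (simp add: num_above_def)
  qed
  have "b \<notin> A" using insert by auto
  then show ?case using insert by (simp add: A b qnum_Suc add.commute)
qed

text \<open>
  The elements of \<open>W\<close> above \<open>v\<close> contribute the exponents \<open>0, \<dots>, r - 1\<close> and those below \<open>v\<close> the
  exponents \<open>r, \<dots>, card W - 1\<close>, where \<open>r = num_above W v\<close>. Shifting the first block by \<open>card W\<close>
  therefore produces the contiguous range from \<open>r\<close> to \<open>r + card W - 1\<close>. This is the cyclic shift
  behind the product formula for the signed major index.
\<close>

lemma sum_power_num_above_shifted:
  fixes W :: "'b::linorder set"
  assumes "finite W" "v \<notin> W"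
  shows "(\<Sum>w\<in>W. (if v < w then p ^ card W else 1) * p ^ num_above W w)
       = p ^ num_above W v * qnum (card W) p"
proof -
  define U where "U = {w \<in> W. v < w}"
  define L where "L = {w \<in> W. w < v}"
  have W: "W = U \<union> L" "U \<inter> L = {}" and fin: "finite U" "finite L"
    using assms by (auto simp: U_def L_def) (metis linorder_less_linear)
  have cU: "card U = num_above W v" by (simp add: U_def num_above_def)
  have cW: "card W = card U + card L" using W fin by (simp add: card_Un_disjoint)
  have U: "num_above W w = num_above U w" if "w \<in> U" for w
    unfolding num_above_def by (rule arg_cong[of _ _ card]) (use that in \<open>auto simp: U_def\<close>)
  have L: "num_above W w = card U + num_above L w" if "w \<in> L" for w
  proof -
    have "{u \<in> W. w < u} = U \<union> {u \<in> L. w < u}" using that assms(2) unfolding U_def L_def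
      by (auto intro: less_trans) (metis linorder_less_linear)
    moreover have "U \<inter> {u \<in> L. w < u} = {}" using W(2) by blast
    ultimately show ?thesis unfolding num_above_def using fin
      by (simp add: card_Un_disjoint)
  qed
  have "(\<Sum>w\<in>W. (if v < w then p ^ card W else 1) * p ^ num_above W w)
     = (\<Sum>w\<in>U. (if v < w then p ^ card W else 1) * p ^ num_above W w)
     + (\<Sum>w\<in>L. (if v < w then p ^ card W else 1) * p ^ num_above W w)"
    by (subst (1) W(1)) (rule sum.union_disjoint[OF fin W(2)])
  also have "(\<Sum>w\<in>U. (if v < w then p ^ card W else 1) * p ^ num_above W w)
     = (\<Sum>w\<in>U. p ^ card W * p ^ num_above U w)"
    by (rule sum.cong) (auto simp: U, auto simp: U_def)
  also have "\<dots> = p ^ card W * qnum (card U) p"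
    by (simp add: sum_power_num_above fin flip: sum_distrib_left)
  also have "(\<Sum>w\<in>L. (if v < w then p ^ card W else 1) * p ^ num_above W w)
     = (\<Sum>w\<in>L. p ^ card U * p ^ num_above L w)"
    by (rule sum.cong) (auto simp: L power_add, auto simp: L_def)
  also have "\<dots> = p ^ card U * qnum (card L) p"
    by (simp add: sum_power_num_above fin flip: sum_distrib_left)
  also have "p ^ card W * qnum (card U) p + p ^ card U * qnum (card L) p
     = p ^ card U * qnum (card L + card U) p"
    by (simp add: qnum_add cW power_add algebra_simps)
  finally show ?thesis by (simp add: cU cW add.commute)
qed

lemma sum_permutations_of_set_by_head:
  assumes "finite V" "V \<noteq> {}"
  shows "(\<Sum>xs\<in>permutations_of_set V. f xs)
       = (\<Sum>v\<in>V. \<Sum>ys\<in>permutations_of_set (V - {v}). f (v # ys))"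
proof -
  have "(\<Sum>xs\<in>permutations_of_set V. f xs)
      = (\<Sum>xs\<in>(\<Union>v\<in>V. (#) v ` permutations_of_set (V - {v})). f xs)"
    using permutations_of_set_nonempty[OF assms(2)] by simp
  also have "\<dots> = (\<Sum>v\<in>V. \<Sum>xs\<in>(#) v ` permutations_of_set (V - {v}). f xs)"
    by (rule sum.UNION_disjoint) (use assms in auto)
  also have "\<dots> = (\<Sum>v\<in>V. \<Sum>ys\<in>permutations_of_set (V - {v}). f (v # ys))"
    by (simp add: sum.reindex)
  finally show ?thesis .
qed

lemma num_above_Diff_self: "num_above (V - {v}) v = num_above V v"
  unfolding num_above_def by (rule arg_cong[of _ _ card]) auto

lemma inversions_Cons:
  assumes "ys \<in> permutations_of_set (V - {v})"
  shows "inversions (v # ys) = num_above V v + inversions ys"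
  using permutations_of_setD(1)[OF assms] num_above_Diff_self[of V v]
  by (simp add: num_above_def)

lemma sum_power_inversions:
  fixes V :: "'b::linorder set" and p :: "'a::comm_ring_1"
  assumes "finite V"
  shows "(\<Sum>xs\<in>permutations_of_set V. p ^ inversions xs) = (\<Prod>k=1..card V. qnum k p)"
  using assms
proof (induction "card V" arbitrary: V)
  case 0
  then show ?case by simp
next
  case (Suc m)
  then have "V \<noteq> {}" by auto
  have "(\<Sum>xs\<in>permutations_of_set V. p ^ inversions xs)
      = (\<Sum>v\<in>V. \<Sum>ys\<in>permutations_of_set (V - {v}). p ^ num_above V v * p ^ inversions ys)"
    unfolding sum_permutations_of_set_by_head[OF \<open>finite V\<close> \<open>V \<noteq> {}\<close>]
    by (intro sum.cong refl) (simp only: inversions_Cons power_add)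
  also have "\<dots> = (\<Sum>v\<in>V. p ^ num_above V v * (\<Prod>k=1..m. qnum k p))"
  proof (intro sum.cong refl)
    fix v assume "v \<in> V"
    then have c: "m = card (V - {v})" using Suc by (simp flip: Suc(2))
    show "(\<Sum>ys\<in>permutations_of_set (V - {v}). p ^ num_above V v * p ^ inversions ys)
        = p ^ num_above V v * (\<Prod>k=1..m. qnum k p)"
      using Suc(1)[OF c] Suc(3) c by (simp flip: sum_distrib_left)
  qed
  also have "\<dots> = qnum (card V) p * (\<Prod>k=1..m. qnum k p)"
    using Suc by (simp add: sum_power_num_above flip: sum_distrib_right)
  finally show ?case by (simp flip: Suc(2) add: mult.commute)
qed

text \<open>
  The refinement by the last letter \<open>v\<close> makes the signed enumeration of the major index inductive.
  Let \<open>m\<close> be the number of letters before \<open>v\<close>. If the letter before \<open>v\<close> is \<open>w\<close>, the induction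
  hypothesis gives \<open>w\<close> the weight \<open>t ^ i\<close>, where \<open>t = (- 1) ^ (m - 1) * q\<close> and \<open>i\<close> counts the larger
  ones among the \<open>m\<close> letters. The descent at position \<open>m\<close>, present exactly when \<open>w\<close> exceeds \<open>v\<close>, contributes \<open>q ^ m\<close>. Because
  \<open>t ^ m = q ^ m\<close>, the descent amounts to a shift of the exponent of \<open>t\<close> by \<open>m\<close>, so that the sum over
  \<open>w\<close> is the one in \<open>sum_power_num_above_shifted\<close>. The sign of the inversions ending in \<open>v\<close> finally
  turns \<open>t\<close> into \<open>- t\<close>, which is the base belonging to \<open>m + 1\<close> letters.
\<close>

lemma sum_signed_major_last:
  fixes V :: "'b::linorder set" and q :: "'a::comm_ring_1"
  assumes "finite V" "v \<in> V"
  shows "(\<Sum>ys\<in>permutations_of_set (V - {v}). (- 1) ^ inversions (v # ys) * q ^ major (v # ys))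
       = ((- 1) ^ (card V - 1) * q) ^ num_above V v
         * (\<Prod>k=1..card V - 1. qnum k ((- 1) ^ (k - 1) * q))"
  using assms
proof (induction "card V - 1" arbitrary: V v)
  case 0
  then have "V = {v}"
    by (metis One_nat_def Suc_pred card_1_singletonE card_gt_0_iff empty_iff singletonD)
  then show ?case by (simp add: num_above_def cong: conj_cong)
next
  case (Suc j)
  define W where "W = V - {v}"
  define t where "t = (- 1) ^ j * q"
  define r where "r = num_above V v"
  have W: "finite W" "v \<notin> W" "card W = Suc j"
    using Suc(2-4) by (auto simp: W_def)
  then have Wne: "W \<noteq> {}" by auto
  have cV: "card V = Suc (Suc j)" using Suc(2) by simp
  have rW: "num_above W v = r" by (simp add: W_def r_def num_above_Diff_self)
  \<comment> \<open>The signs cancel because \<open>j * (j + 1)\<close> is even.\<close>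
  have tq: "t ^ card W = q ^ Suc j"
  proof -
    have "((- 1) ^ j :: 'a) ^ Suc j = 1"
      unfolding power_mult[symmetric] by (rule neg_one_even_power) simp
    then show ?thesis by (simp only: t_def W power_mult_distrib) simp
  qed
  have "(\<Sum>ys\<in>permutations_of_set W. (- 1) ^ inversions (v # ys) * q ^ major (v # ys))
     = (\<Sum>w\<in>W. \<Sum>zs\<in>permutations_of_set (W - {w}). (- 1) ^ inversions (v # w # zs) * q ^ major (v # w # zs))"
    by (rule sum_permutations_of_set_by_head[OF W(1) Wne])
  also have "\<dots> = (\<Sum>w\<in>W. \<Sum>zs\<in>permutations_of_set (W - {w}).
       (- 1) ^ r * (if v < w then t ^ card W else 1) * ((- 1) ^ inversions (w # zs) * q ^ major (w # zs)))"
  proof (intro sum.cong refl)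
    fix w zs assume wz: "w \<in> W" "zs \<in> permutations_of_set (W - {w})"
    then have "w # zs \<in> permutations_of_set (V - {v})"
      unfolding permutations_of_set_nonempty[OF Wne] W_def[symmetric] by blast
    then have i: "inversions (v # w # zs) = r + inversions (w # zs)"
      unfolding r_def by (rule inversions_Cons)
    have "length zs = j" using wz W by (simp add: permutations_of_set_def) (metis card_Diff_singleton diff_Suc_1 distinct_card)
    then have m: "q ^ major (v # w # zs) = (if v < w then t ^ card W else 1) * q ^ major (w # zs)"
      by (simp add: tq power_add)
    show "(- 1) ^ inversions (v # w # zs) * q ^ major (v # w # zs) =
       (- 1) ^ r * (if v < w then t ^ card W else 1) * ((- 1) ^ inversions (w # zs) * q ^ major (w # zs))"
      unfolding i m power_add by (simp add: algebra_simps)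
  qed
  also have "\<dots> = (\<Sum>w\<in>W. (- 1) ^ r * (if v < w then t ^ card W else 1) *
      (t ^ num_above W w * (\<Prod>k=1..j. qnum k ((- 1) ^ (k - 1) * q))))"
  proof (intro sum.cong refl)
    fix w assume w: "w \<in> W"
    show "(\<Sum>zs\<in>permutations_of_set (W - {w}).
       (- 1) ^ r * (if v < w then t ^ card W else 1) * ((- 1) ^ inversions (w # zs) * q ^ major (w # zs))) =
       (- 1) ^ r * (if v < w then t ^ card W else 1) *
      (t ^ num_above W w * (\<Prod>k=1..j. qnum k ((- 1) ^ (k - 1) * q)))"
      using Suc(1)[of W w] W w unfolding sum_distrib_left[symmetric] by (simp add: t_def)
  qed
  also have "\<dots> = (- 1) ^ r * (\<Prod>k=1..j. qnum k ((- 1) ^ (k - 1) * q)) *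
      (\<Sum>w\<in>W. (if v < w then t ^ card W else 1) * t ^ num_above W w)"
    unfolding sum_distrib_left by (intro sum.cong refl) (simp add: algebra_simps)
  also have "(\<Sum>w\<in>W. (if v < w then t ^ card W else 1) * t ^ num_above W w) = t ^ r * qnum (Suc j) t"
    using sum_power_num_above_shifted[OF W(1,2), of t] by (simp only: rW W(3))
  also have "(- 1) ^ r * (\<Prod>k=1..j. qnum k ((- 1) ^ (k - 1) * q)) * (t ^ r * qnum (Suc j) t)
     = (- t) ^ r * (\<Prod>k=1..Suc j. qnum k ((- 1) ^ (k - 1) * q))"
    by (subst (2) power_minus) (simp add: t_def algebra_simps)
  also have "- t = (- 1) ^ (card V - 1) * q" by (simp add: t_def cV)
  finally show ?case by (simp only: W_def r_def cV diff_Suc_1)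
qed

text \<open>
  The Gessel--Simion formula, for the rearrangements of an arbitrary finite set.
\<close>

lemma sum_signed_major:
  fixes V :: "'b::linorder set" and q :: "'a::comm_ring_1"
  assumes "finite V"
  shows "(\<Sum>xs\<in>permutations_of_set V. (- 1) ^ inversions xs * q ^ major xs)
       = (\<Prod>k=1..card V. qnum k ((- 1) ^ (k - 1) * q))"
proof (cases "V = {}")
  case True
  then show ?thesis by simp
next
  case False
  then obtain m where m: "card V = Suc m" using assms by (metis card_eq_0_iff not0_implies_Suc)
  have "(\<Sum>xs\<in>permutations_of_set V. (- 1) ^ inversions xs * q ^ major xs)
      = (\<Sum>v\<in>V. ((- 1) ^ m * q) ^ num_above V v
           * (\<Prod>k=1..m. qnum k ((- 1) ^ (k - 1) * q)))"
    unfolding sum_permutations_of_set_by_head[OF assms False]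
    by (intro sum.cong refl) (simp only: sum_signed_major_last[OF assms] m diff_Suc_1)
  also have "\<dots> = qnum (Suc m) ((- 1) ^ m * q) * (\<Prod>k=1..m. qnum k ((- 1) ^ (k - 1) * q))"
    unfolding sum_distrib_right[symmetric] sum_power_num_above[OF assms] m by (rule refl)
  finally show ?thesis by (simp add: m mult.commute)
qed

section \<open>Even subsets\<close>

text \<open>
  The element \<open>1\<close> has weight \<open>x ^ 0\<close>, so it can be used to correct the parity of any subset of
  \<open>{2..Suc n}\<close>: subsets of either parity have the same generating function as all subsets of
  \<open>{2..Suc n}\<close>. For the induction on \<open>n\<close> both parities are treated together, since inserting the
  new largest element switches between them.
\<close>

lemma sum_Pow_by_parity:
  fixes x :: "'a::comm_ring_1"
  shows "(\<Sum>A | A \<subseteq> {1..Suc n} \<and> (even (card A) \<longleftrightarrow> e). x ^ (\<Sum>a\<in>A. a - 1)) = (\<Prod>k=1..n. 1 + x ^ k)"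
proof (induction n arbitrary: e)
  case 0
  have "{A. A \<subseteq> {1..Suc 0} \<and> (even (card A) \<longleftrightarrow> e)} = {if e then {} else {1}}"
    by (auto simp: subset_singleton_iff)
  then show ?case by simp
next
  case (Suc n)
  let ?S = "\<lambda>n e. {A. A \<subseteq> {1..Suc n} \<and> (even (card A) \<longleftrightarrow> e)}"
  have fin: "finite A" if "A \<subseteq> {1..Suc n}" for A using that finite_subset by blast
  have ni: "Suc (Suc n) \<notin> A" if "A \<subseteq> {1..Suc n}" for A using that by auto
  have S: "?S (Suc n) e = ?S n e \<union> insert (Suc (Suc n)) ` ?S n (\<not> e)"
  proof (intro equalityI subsetI)
    fix A assume A: "A \<in> ?S (Suc n) e"
    show "A \<in> ?S n e \<union> insert (Suc (Suc n)) ` ?S n (\<not> e)"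
    proof (cases "Suc (Suc n) \<in> A")
      case True
      define B where "B = A - {Suc (Suc n)}"
      have B: "B \<subseteq> {1..Suc n}" using A by (auto simp: B_def le_Suc_eq)
      have i: "A = insert (Suc (Suc n)) B" using True by (auto simp: B_def)
      have "card A = Suc (card B)"
        unfolding i using B by (intro card_insert_disjoint fin ni)
      then have "B \<in> ?S n (\<not> e)" using A B by auto
      then show ?thesis unfolding i by blast
    next
      case False
      then have "A \<subseteq> {1..Suc n}" using A by (auto simp: le_Suc_eq)
      then show ?thesis using A by blast
    qed
  next
    fix A assume "A \<in> ?S n e \<union> insert (Suc (Suc n)) ` ?S n (\<not> e)"
    then consider "A \<in> ?S n e" | B where "B \<in> ?S n (\<not> e)" "A = insert (Suc (Suc n)) B"
      by blast
    then show "A \<in> ?S (Suc n) e"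
    proof cases
      case 1
      then show ?thesis by fastforce
    next
      case 2
      then have "card A = Suc (card B)" using fin ni by simp
      then show ?thesis using 2 by fastforce
    qed
  qed
  have inj: "inj_on (insert (Suc (Suc n))) (?S n (\<not> e))"
    using ni by (intro inj_onI) (metis (no_types, lifting) insert_ident mem_Collect_eq)
  have fS: "finite (?S n e)" for e by (rule finite_subset[of _ "Pow {1..Suc n}"]) auto
  have "(\<Sum>A\<in>?S (Suc n) e. x ^ (\<Sum>a\<in>A. a - 1)) = (\<Sum>A\<in>?S n e. x ^ (\<Sum>a\<in>A. a - 1))
     + (\<Sum>A\<in>insert (Suc (Suc n)) ` ?S n (\<not> e). x ^ (\<Sum>a\<in>A. a - 1))"
    unfolding S by (rule sum.union_disjoint) (use fS ni in \<open>blast+\<close>)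
  also have "(\<Sum>A\<in>insert (Suc (Suc n)) ` ?S n (\<not> e). x ^ (\<Sum>a\<in>A. a - 1))
     = (\<Sum>A\<in>?S n (\<not> e). x ^ Suc n * x ^ (\<Sum>a\<in>A. a - 1))"
    unfolding sum.reindex[OF inj] o_def
  proof (intro sum.cong refl)
    fix A assume "A \<in> ?S n (\<not> e)"
    then have "(\<Sum>a\<in>insert (Suc (Suc n)) A. a - 1) = Suc n + (\<Sum>a\<in>A. a - 1)"
      using fin ni by simp
    then show "x ^ (\<Sum>a\<in>insert (Suc (Suc n)) A. a - 1) = x ^ Suc n * x ^ (\<Sum>a\<in>A. a - 1)"
      by (simp only: power_add)
  qed
  finally show ?case unfolding sum_distrib_left[symmetric] Suc.IH by (simp add: algebra_simps)
qed

section \<open>The Coxeter length\<close>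

text \<open>
  A statistic that vanishes at the identity, grows by at most one with each generator, and can be
  lowered by one at any other element is the word length. The growth bound yields \<open>\<ge>\<close>, and
  repeated lowering yields a word proving \<open>\<le>\<close>. Words grow on the right here, so that a generator
  acts on the positions of a signed permutation.
\<close>

lemma word_length_eqI:
  fixes L :: "('b \<Rightarrow> 'b) \<Rightarrow> nat"
  assumes "g \<in> G"
    and id: "id \<in> G" "L id = 0"
    and closed: "\<And>g s. g \<in> G \<Longrightarrow> s \<in> S \<Longrightarrow> g \<circ> s \<in> G"
    and invol: "\<And>s. s \<in> S \<Longrightarrow> s \<circ> s = id"
    and step: "\<And>g s. g \<in> G \<Longrightarrow> s \<in> S \<Longrightarrow> L (g \<circ> s) \<le> Suc (L g)"
    and descent: "\<And>g. g \<in> G \<Longrightarrow> g \<noteq> id \<Longrightarrow> \<exists>s\<in>S. Suc (L (g \<circ> s)) = L g"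
  shows "word_length S g = L g"
  unfolding word_length_def
proof (rule Least_equality)
  have append: "foldr (\<circ>) (ws @ [s]) id = foldr (\<circ>) ws id \<circ> s" for ws :: "('b \<Rightarrow> 'b) list" and s
    by (induction ws) (simp_all add: comp_assoc)
  show "\<exists>ws. length ws = L g \<and> set ws \<subseteq> S \<and> foldr (\<circ>) ws id = g"
    using \<open>g \<in> G\<close>
  proof (induction "L g" arbitrary: g)
    case 0
    then have "foldr (\<circ>) [] id = g" using descent[OF 0(2)] by fastforce
    then show ?case using 0(1) by (intro exI[of _ "[]"]) simp
  next
    case (Suc k)
    have "g \<noteq> id" using Suc(2) id by auto
    then obtain s where s: "s \<in> S" "Suc (L (g \<circ> s)) = L g" using descent Suc by blast
    then obtain ws where ws: "length ws = L (g \<circ> s)" "set ws \<subseteq> S" "foldr (\<circ>) ws id = g \<circ> s"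
      using Suc(1)[of "g \<circ> s"] Suc(2,3) closed by auto
    have "foldr (\<circ>) (ws @ [s]) id = g"
      unfolding append ws using invol[OF s(1)] by (simp add: comp_assoc)
    then show ?case using ws s by (intro exI[of _ "ws @ [s]"]) simp
  qed
  fix k assume "\<exists>ws. length ws = k \<and> set ws \<subseteq> S \<and> foldr (\<circ>) ws id = g"
  then obtain ws where ws: "length ws = k" "set ws \<subseteq> S" "foldr (\<circ>) ws id = g" by blast
  have "foldr (\<circ>) ws id \<in> G \<and> L (foldr (\<circ>) ws id) \<le> length ws" using ws(2)
  proof (induction ws rule: rev_induct)
    case Nil
    have e: "foldr (\<circ>) [] id = (id :: 'b \<Rightarrow> 'b)" by simp
    show ?case by (simp only: e id le0)
  next
    case (snoc s ws)
    have s: "s \<in> S" "set ws \<subseteq> S" using snoc.prems by auto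
    have IH: "foldr (\<circ>) ws id \<in> G" "L (foldr (\<circ>) ws id) \<le> length ws"
      using snoc.IH[OF s(2)] by blast+
    have "length (ws @ [s]) = Suc (length ws)" by simp
    then show ?case
      using closed[OF IH(1) s(1)] step[OF IH(1) s(1)] IH(2) unfolding append
      by (metis Suc_le_mono le_trans)
  qed
  then show "L g \<le> k" using ws by simp
qed

abbreviation letters :: "nat \<Rightarrow> int set" where
  "letters n \<equiv> {- int n..int n} - {0}"

lemma signed_permsD:
  assumes "\<pi> \<in> signed_perms n"
  shows "\<pi> permutes letters n" "\<pi> (- i) = - \<pi> i" "\<pi> 0 = 0" "\<pi> i = \<pi> j \<longleftrightarrow> i = j"
    "\<pi> i \<in> letters n \<longleftrightarrow> i \<in> letters n"
proof -
  show p: "\<pi> permutes letters n" and "\<pi> (- i) = - \<pi> i" using assms by (auto simp: signed_perms_def)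
  show "\<pi> 0 = 0" using p by (auto simp: permutes_def)
  show "\<pi> i = \<pi> j \<longleftrightarrow> i = j" using permutes_inj[OF p] by (auto dest: injD)
  show "\<pi> i \<in> letters n \<longleftrightarrow> i \<in> letters n" by (rule permutes_in_image[OF p])
qed

lemma signed_perms_comp:
  assumes "\<pi> \<in> signed_perms n" "\<sigma> \<in> signed_perms n"
  shows "\<pi> \<circ> \<sigma> \<in> signed_perms n"
  using assms by (auto simp: signed_perms_def intro: permutes_compose)

lemma signed_perm_pos:
  assumes "\<pi> \<in> signed_perms n" "i \<in> {1..int n}"
  shows "\<pi> i \<noteq> 0" "\<bar>\<pi> i\<bar> \<in> {1..int n}"
  using signed_permsD(5)[OF assms(1), of i] assms(2) by auto

lemma bij_betw_abs_signed_perm: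
  assumes "\<pi> \<in> signed_perms n"
  shows "bij_betw (\<lambda>i. \<bar>\<pi> i\<bar>) {1..int n} {1..int n}"
proof -
  have "inj_on (\<lambda>i. \<bar>\<pi> i\<bar>) {1..int n}"
  proof (rule inj_onI)
    fix i j assume ij: "i \<in> {1..int n}" "j \<in> {1..int n}" "\<bar>\<pi> i\<bar> = \<bar>\<pi> j\<bar>"
    then have "\<pi> i = \<pi> j \<or> \<pi> i = \<pi> (- j)" 
      unfolding signed_permsD(2)[OF assms] by (simp add: abs_eq_iff)
    then have "i = j \<or> i = - j" by (simp only: signed_permsD(4)[OF assms])
    then show "i = j" using ij by auto
  qed
  moreover have "(\<lambda>i. \<bar>\<pi> i\<bar>) ` {1..int n} \<subseteq> {1..int n}" using signed_perm_pos[OF assms] by blast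
  ultimately show ?thesis by (simp add: bij_betw_def endo_inj_surj)
qed

text \<open>
  A pair \<open>(a, b)\<close> with \<open>a \<noteq> - b\<close> stands for the vector \<open>e\<^sub>b - e\<^sub>a\<close> with \<open>e\<^bsub>-i\<^esub> = - e\<^sub>i\<close>, which is a
  root of type \<open>D\<close>, positive if \<open>a < b\<close>. The pairs \<open>(a, b)\<close> and \<open>(- b, - a)\<close> stand for the same root.
  Thus \<open>root_inversions n \<pi>\<close> lists every positive root sent to a negative one exactly twice. Keeping
  both copies avoids choosing a representative, and makes the action of a generator on roots simply
  \<open>map_prod s s\<close>.
\<close>

definition root_inversions :: "nat \<Rightarrow> (int \<Rightarrow> int) \<Rightarrow> (int \<times> int) set" where
  "root_inversions n \<pi> =
     {(a, b). a \<in> letters n \<and> b \<in> letters n \<and> a < b \<and> a \<noteq> - b \<and> \<pi> b < \<pi> a}"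

text \<open>
  A simple reflection is characterised by having its own root as the only inversion.
\<close>

definition reflects_root :: "nat \<Rightarrow> (int \<Rightarrow> int) \<Rightarrow> int \<times> int \<Rightarrow> bool" where
  "reflects_root n s = (\<lambda>(a, b). s \<in> signed_perms n \<and> s \<circ> s = id \<and> s a = b \<and>
     root_inversions n s = {(a, b), (- b, - a)})"

lemma finite_root_inversions: "finite (root_inversions n \<pi>)"
  by (rule finite_subset[of _ "letters n \<times> letters n"]) (auto simp: root_inversions_def)

text \<open>
  A simple reflection permutes the positive roots other than its own and negates that one. Hence
  \<open>\<pi>\<close> and \<open>\<pi> \<circ> s\<close> have equally many inversions among the other roots, and the root of \<open>s\<close>, counted
  twice, is an inversion of precisely one of them.
\<close>

lemma card_root_inversions_comp_descent:
  assumes pi: "\<pi> \<in> signed_perms n" and s: "reflects_root n s (a, b)" and less: "\<pi> b < \<pi> a"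
  shows "card (root_inversions n \<pi>) = card (root_inversions n (\<pi> \<circ> s)) + 2"
proof -
  have sp: "s \<in> signed_perms n" and ss: "s (s x) = x" and sa: "s a = b" 
    and R: "root_inversions n s = {(a, b), (- b, - a)}" for x
    using s by (auto simp: reflects_root_def fun_eq_iff)
  have sb: "s b = a" using ss[of a] sa by simp
  note S = signed_permsD[OF sp] and P = signed_permsD[OF pi]
  let ?I = "root_inversions n \<pi>" and ?J = "root_inversions n (\<pi> \<circ> s)"
  let ?R = "root_inversions n s"
  have ab: "a \<in> letters n" "b \<in> letters n" "a < b" "a \<noteq> - b"
    using R by (auto simp: root_inversions_def)
  have RI: "?R \<subseteq> ?I" unfolding R using ab less by (auto simp: root_inversions_def P)
  have RJ: "?R \<inter> ?J = {}" unfolding R using less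
    by (auto simp: root_inversions_def P S sa sb)
  have up: "(s c, s d) \<in> root_inversions n (\<rho> \<circ> s) - ?R" if cd: "(c, d) \<in> root_inversions n \<rho> - ?R"
    for c d \<rho>
  proof -
    have cd': "c \<in> letters n" "d \<in> letters n" "c < d" "c \<noteq> - d" "\<rho> d < \<rho> c" "\<not> s d < s c"
      using cd by (auto simp: root_inversions_def)
    then have "s c < s d" "s c \<noteq> - s d" using S(4)[of c d] S(4)[of c "- d"] S(2) by auto
    then show ?thesis using cd' S(5) by (auto simp: root_inversions_def ss)
  qed
  have "bij_betw (map_prod s s) (?I - ?R) ?J"
  proof (rule bij_betw_byWitness[where f' = "map_prod s s"])
    show "map_prod s s ` (?I - ?R) \<subseteq> ?J" using up[of _ _ \<pi>] by auto
    have "\<pi> \<circ> s \<circ> s = \<pi>" by (simp add: fun_eq_iff ss)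
    then show "map_prod s s ` ?J \<subseteq> ?I - ?R" using up[of _ _ "\<pi> \<circ> s"] RJ by fastforce
  qed (auto simp: ss)
  then have "card (?I - ?R) = card ?J" by (rule bij_betw_same_card)
  moreover have "card ?R = 2" unfolding R using ab by (auto simp: card_insert_if)
  moreover have "card ?I = card (?I - ?R) + card ?R"
    using card_mono[OF finite_root_inversions RI] by (simp add: card_Diff_subset RI finite_root_inversions)
  ultimately show ?thesis by simp
qed

lemma card_root_inversions_comp_ascent:
  assumes pi: "\<pi> \<in> signed_perms n" and s: "reflects_root n s (a, b)" and less: "\<pi> a < \<pi> b"
  shows "card (root_inversions n (\<pi> \<circ> s)) = card (root_inversions n \<pi>) + 2"
proof -
  have sp: "s \<in> signed_perms n" and ss: "s \<circ> s = id" and sa: "s a = b"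
    using s by (auto simp: reflects_root_def)
  have "s b = a" using ss sa by (metis comp_apply id_apply)
  then have "(\<pi> \<circ> s) b < (\<pi> \<circ> s) a" using less sa by simp
  from card_root_inversions_comp_descent[OF signed_perms_comp[OF pi sp] s this]
  show ?thesis by (simp only: comp_assoc ss comp_id)
qed

lemma simple_refl_apply:
  assumes "i \<ge> 1"
  shows "simple_refl i x = (if x = i then i + 1 else if x = i + 1 then i
     else if x = - i then - (i + 1) else if x = - (i + 1) then - i else x)"
  using assms by (auto simp: simple_refl_def transpose_def)

lemma simple_refl0_apply:
  "simple_refl0 x = (if x = 1 then - 2 else if x = - 2 then 1
     else if x = - 1 then 2 else if x = 2 then - 1 else x)"
  by (auto simp: simple_refl0_def transpose_def)

lemma signed_permsI:
  assumes "\<And>x. s (s x) = x" "\<And>x. s (- x) = - s x" "\<And>x. x \<notin> letters n \<Longrightarrow> s x = x"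
  shows "s \<in> signed_perms n"
  using assms unfolding signed_perms_def permutes_def by (simp; metis)

lemma reflects_root_simple_refl:
  assumes "i \<in> {1..int n - 1}"
  shows "reflects_root n (simple_refl i) (i, i + 1)"
proof -
  have i: "i \<ge> 1" using assms by simp
  have "simple_refl i \<in> signed_perms n"
    by (rule signed_permsI) (use assms in \<open>auto simp: simple_refl_apply\<close>)
  moreover have "simple_refl i \<circ> simple_refl i = id"
    using i by (auto simp: simple_refl_apply fun_eq_iff)
  moreover have "root_inversions n (simple_refl i) = {(i, i + 1), (- (i + 1), - i)}"
  proof (intro equalityI subsetI)
    fix r assume "r \<in> root_inversions n (simple_refl i)"
    then obtain c d where r: "r = (c, d)" and cd: "c < d" "c \<noteq> - d" "simple_refl i d < simple_refl i c"
      by (auto simp: root_inversions_def)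
    have "c = i \<and> d = i + 1 \<or> c = - (i + 1) \<and> d = - i"
      using cd i simple_refl_apply[OF i, of c] simple_refl_apply[OF i, of d] by (smt (verit))
    then show "r \<in> {(i, i + 1), (- (i + 1), - i)}" using r by blast
  next
    fix r assume "r \<in> {(i, i + 1), (- (i + 1), - i)}"
    then show "r \<in> root_inversions n (simple_refl i)"
      using assms by (auto simp: root_inversions_def simple_refl_apply)
  qed
  ultimately show ?thesis using i by (simp add: reflects_root_def simple_refl_apply)
qed

lemma reflects_root_simple_refl0:
  assumes "n \<ge> 2"
  shows "reflects_root n simple_refl0 (- 1, 2)"
proof -
  have "simple_refl0 \<in> signed_perms n"
    by (rule signed_permsI) (use assms in \<open>auto simp: simple_refl0_apply\<close>)
  moreover have "simple_refl0 \<circ> simple_refl0 = id"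
    by (auto simp: simple_refl0_apply fun_eq_iff)
  moreover have "root_inversions n simple_refl0 = {(- 1, 2), (- 2, 1)}"
  proof (intro equalityI subsetI)
    fix r assume "r \<in> root_inversions n simple_refl0"
    then obtain c d where r: "r = (c, d)" and cd: "c < d" "c \<noteq> - d" "c \<noteq> 0" "d \<noteq> 0"
        "simple_refl0 d < simple_refl0 c"
      by (auto simp: root_inversions_def)
    have "c = - 1 \<and> d = 2 \<or> c = - 2 \<and> d = 1"
      using cd simple_refl0_apply[of c] simple_refl0_apply[of d] by (smt (verit))
    then show "r \<in> {(- 1, 2), (- 2, 1)}" using r by blast
  next
    fix r :: "int \<times> int" assume "r \<in> {(- 1, 2), (- 2, 1)}"
    then show "r \<in> root_inversions n simple_refl0"
      using assms by (auto simp: root_inversions_def simple_refl0_apply)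
  qed
  ultimately show ?thesis by (simp add: reflects_root_def simple_refl0_apply)
qed

definition neg_values :: "nat \<Rightarrow> (int \<Rightarrow> int) \<Rightarrow> nat set" where
  "neg_values n \<pi> = {k \<in> {1..n}. - int k \<in> \<pi> ` {1..int n}}"

lemma bij_betw_Neg_values:
  assumes "\<pi> \<in> signed_perms n"
  shows "bij_betw (\<lambda>i. nat (- \<pi> i)) (Neg n \<pi>) (neg_values n \<pi>)"
proof (rule bij_betwI')
  fix i j assume "i \<in> Neg n \<pi>" "j \<in> Neg n \<pi>"
  then show "nat (- \<pi> i) = nat (- \<pi> j) \<longleftrightarrow> i = j"
    using signed_permsD(4)[OF assms, of i j] by (auto simp: Neg_def nat_eq_iff)
next
  fix i assume "i \<in> Neg n \<pi>"
  then show "nat (- \<pi> i) \<in> neg_values n \<pi>"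
    using signed_perm_pos[OF assms, of i] by (auto simp: Neg_def neg_values_def)
next
  fix k assume "k \<in> neg_values n \<pi>"
  then show "\<exists>i\<in>Neg n \<pi>. k = nat (- \<pi> i)"
    by (force simp: Neg_def neg_values_def)
qed

lemma neg_eq_card:
  assumes "\<pi> \<in> signed_perms n"
  shows "neg n \<pi> = card (neg_values n \<pi>)"
  unfolding neg_def by (rule bij_betw_same_card[OF bij_betw_Neg_values[OF assms]])

lemma sum_Neg_eq:
  assumes "\<pi> \<in> signed_perms n"
  shows "(\<Sum>i\<in>Neg n \<pi>. nat (- \<pi> i) - 1) = (\<Sum>k\<in>neg_values n \<pi>. k - 1)"
  by (rule sum.reindex_bij_betw[OF bij_betw_Neg_values[OF assms], where g = "\<lambda>k. k - 1"])

text \<open>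
  Without descents the values satisfy \<open>- \<pi> 1 < \<pi> 2 < \<dots> < \<pi> n\<close> and \<open>\<pi> 1 < \<pi> 2\<close>, so that at most the
  first one is negative. As their number is even, all are positive, and an increasing sequence of
  \<open>n\<close> values in \<open>{1..n}\<close> is the identity.
\<close>

lemma exists_descent:
  assumes pi: "\<pi> \<in> even_signed_perms n" and "\<pi> \<noteq> id"
  shows "\<exists>s\<in>D_generators n. \<exists>a b. reflects_root n s (a, b) \<and> \<pi> b < \<pi> a"
proof (rule ccontr)
  assume contra: "\<not> ?thesis"
  have sp: "\<pi> \<in> signed_perms n" and ev: "even (neg n \<pi>)"
    using pi by (auto simp: even_signed_perms_def)
  note P = signed_permsD[OF sp]
  have inc: "\<pi> i < \<pi> (i + 1)" if i: "i \<in> {1..int n - 1}" for i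
    using contra reflects_root_simple_refl[OF i] P(4)[of i "i + 1"] i unfolding D_generators_def
    by (metis UnI1 imageI less_irrefl linorder_less_linear less_add_one)
  have inc0: "- \<pi> 1 < \<pi> 2" if n: "n \<ge> 2"
  proof -
    have "simple_refl0 \<in> D_generators n" using n by (simp add: D_generators_def)
    then have "\<not> \<pi> 2 < \<pi> (- 1)" using contra reflects_root_simple_refl0[OF n] by blast
    moreover have "\<pi> 2 \<noteq> \<pi> (- 1)" using P(4)[of 2 "- 1"] by simp
    ultimately show ?thesis using P(2)[of 1] by simp
  qed
  have mono: "\<pi> i + (j - i) \<le> \<pi> j" if "1 \<le> i" "i \<le> j" "j \<le> int n" for i j
    using that(2,3)
  proof (induction j rule: int_ge_induct)
    case base
    then show ?case by simp
  next
    case (step j)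
    then show ?case using inc[of j] that(1) by simp
  qed
  have pos: "0 < \<pi> i" if i: "i \<in> {1..int n}" for i
  proof -
    have later: "0 < \<pi> j" if j: "2 \<le> j" "j \<le> int n" for j
      using inc0 mono[of 1 2] mono[of 2 j] j by auto
    have "0 < \<pi> 1"
    proof (rule ccontr)
      assume "\<not> 0 < \<pi> 1"
      then have "Neg n \<pi> = {1}"
        using i later signed_perm_pos[OF sp, of 1] unfolding Neg_def
        by (auto simp: not_less) (smt (verit))
      then show False using ev by (simp add: neg_def)
    qed
    then show ?thesis using later i by (cases "i = 1") auto
  qed
  have fix_pos: "\<pi> i = i" if i: "i \<in> {1..int n}" for i
  proof -
    have "\<pi> (int n) \<le> int n" using signed_perm_pos[OF sp, of "int n"] i by auto
    then show ?thesis using mono[of 1 i] mono[of i "int n"] pos[of 1] i by auto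
  qed
  have "\<pi> i = i" for i
  proof (cases "i \<in> letters n")
    case True
    then consider "i \<in> {1..int n}" | "- i \<in> {1..int n}" by fastforce
    then show ?thesis using fix_pos[of i] fix_pos[of "- i"] P(2)[of i] by cases auto
  next
    case False
    then show ?thesis using P(1) by (simp add: permutes_def)
  qed
  then show False using \<open>\<pi> \<noteq> id\<close> by auto
qed

text \<open>
  The one-line notation of \<open>\<pi>\<close>, with the last letter as head of the list.
\<close>

fun rev_word :: "(int \<Rightarrow> int) \<Rightarrow> nat \<Rightarrow> int list" where
  "rev_word \<pi> 0 = []"
| "rev_word \<pi> (Suc m) = \<pi> (int (Suc m)) # rev_word \<pi> m"

lemma atLeastAtMost_int_Suc: "{1..int (Suc m)} = insert (int (Suc m)) {1..int m}"
  by auto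

lemma length_rev_word [simp]: "length (rev_word \<pi> n) = n"
  by (induction n) auto

lemma set_rev_word: "set (rev_word \<pi> n) = \<pi> ` {1..int n}"
  by (induction n) (simp_all only: rev_word.simps list.set atLeastAtMost_int_Suc image_insert, auto)

lemma nth_rev_word: "j < n \<Longrightarrow> rev_word \<pi> n ! j = \<pi> (int (n - j))"
  by (induction n arbitrary: j) (auto simp: nth_Cons split: nat.split)

lemma distinct_rev_word:
  assumes "inj_on \<pi> {1..int n}"
  shows "distinct (rev_word \<pi> n)"
  using card_image[OF assms] by (intro card_distinct) (simp add: set_rev_word)

lemma inversions_rev_word:
  assumes "inj_on \<pi> {1..int n}"
  shows "inversions (rev_word \<pi> n) = card {(a, b). 1 \<le> a \<and> a < b \<and> b \<le> int n \<and> \<pi> b < \<pi> a}"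
  using assms
proof (induction n)
  case 0
  have "{(a, b). 1 \<le> a \<and> a < b \<and> b \<le> int 0 \<and> \<pi> b < \<pi> a} = {}" by auto
  then show ?case by (simp only: rev_word.simps inversions.simps card.empty)
next
  case (Suc m)
  let ?b = "int (Suc m)"
  let ?P = "\<lambda>m. {(a, b). 1 \<le> a \<and> a < b \<and> b \<le> int m \<and> \<pi> b < \<pi> a}"
  let ?A = "{a \<in> {1..int m}. \<pi> ?b < \<pi> a}"
  have inj: "inj_on \<pi> {1..int m}" by (rule inj_on_subset[OF Suc(2)]) auto
  have P: "?P (Suc m) = ?P m \<union> (\<lambda>a. (a, ?b)) ` ?A"
  proof (intro set_eqI)
    fix x :: "int \<times> int"
    obtain a b where x: "x = (a, b)" by (cases x)
    show "x \<in> ?P (Suc m) \<longleftrightarrow> x \<in> ?P m \<union> (\<lambda>a. (a, ?b)) ` ?A"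
      unfolding x by (cases "b = ?b") auto
  qed
  have fin: "finite (?P m)" "finite ?A"
    by (rule finite_subset[of _ "{1..int m} \<times> {1..int m}"], auto)
       (rule finite_subset[of _ "{1..int m}"], auto)
  have "card (?P (Suc m)) = card (?P m) + card ((\<lambda>a. (a, ?b)) ` ?A)"
    unfolding P by (intro card_Un_disjoint fin finite_imageI) auto
  also have "card ((\<lambda>a. (a, ?b)) ` ?A) = card ?A" by (rule card_image) (auto simp: inj_on_def)
  also have "\<dots> = card (\<pi> ` ?A)"
    by (rule card_image[symmetric], rule inj_on_subset[OF inj]) auto
  also have "\<pi> ` ?A = {u \<in> set (rev_word \<pi> m). \<pi> ?b < u}" by (auto simp: set_rev_word)
  finally show ?case using Suc.IH[OF inj] by simp
qed

lemma major_rev_word: "int (major (rev_word \<pi> n)) = maj n \<pi>"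
proof (induction n rule: induct_nat_012)
  case 0
  then show ?case by (simp add: maj_def)
next
  case 1
  then show ?case by (simp add: maj_def)
next
  case (ge2 m)
  let ?D = "\<lambda>n. {i \<in> {1..int n - 1}. \<pi> (i + 1) < \<pi> i}"
  have fin: "finite (?D n)" for n by (rule finite_subset[of _ "{1..int n - 1}"]) auto
  have D: "?D (Suc (Suc m)) = ?D (Suc m) \<union> (if \<pi> (int (Suc (Suc m))) < \<pi> (int (Suc m)) then {int (Suc m)} else {})"
    by (auto simp: add.commute) (smt (verit) of_nat_Suc)+
  have "(\<Sum>i\<in>?D (Suc (Suc m)). i) = (\<Sum>i\<in>?D (Suc m). i)
     + (if \<pi> (int (Suc (Suc m))) < \<pi> (int (Suc m)) then int (Suc m) else 0)"
    unfolding D by (subst sum.union_disjoint[OF fin]) auto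
  then show ?case using ge2 by (simp add: maj_def)
qed

text \<open>
  Inversions with both entries positive, or both negative, are each as many as the inversions of
  the word. Those with entries of opposite sign are the ordered pairs of positions \<open>p \<noteq> r\<close> with
  \<open>\<pi> p + \<pi> r < 0\<close>, which means that the entry of larger absolute value is negative. An entry of value
  \<open>- k\<close> dominates exactly \<open>k - 1\<close> others in this way, and each such pair is counted in both orders.
\<close>

lemma card_root_inversions:
  assumes pi: "\<pi> \<in> signed_perms n"
  shows "card (root_inversions n \<pi>)
       = 2 * (inversions (rev_word \<pi> n) + (\<Sum>k\<in>neg_values n \<pi>. k - 1))"
proof -
  note P = signed_permsD[OF pi]
  let ?N = "{1..int n}"
  define PP where "PP = {(a, b). 1 \<le> a \<and> a < b \<and> b \<le> int n \<and> \<pi> b < \<pi> a}"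
  define T where "T = (SIGMA p:Neg n \<pi>. {r \<in> ?N. \<bar>\<pi> r\<bar> < - \<pi> p})"
  let ?m = "\<lambda>(a, b). (- b, - a) :: int \<times> int"
  let ?l = "\<lambda>(p, r). (- p, r) :: int \<times> int"
  have fin: "finite PP" "finite T"
    by (rule finite_subset[of _ "?N \<times> ?N"], auto simp: PP_def T_def Neg_def)+
  have PPe: "x \<in> PP \<longleftrightarrow> 1 \<le> fst x \<and> fst x < snd x \<and> snd x \<le> int n \<and> \<pi> (snd x) < \<pi> (fst x)" for x
    by (auto simp: PP_def split: prod.split)
  have Te: "(p, r) \<in> T \<longleftrightarrow> p \<in> ?N \<and> r \<in> ?N \<and> \<bar>\<pi> r\<bar> < - \<pi> p" for p r
    by (auto simp: T_def Neg_def)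
  have abs_inj: "\<bar>\<pi> i\<bar> = \<bar>\<pi> j\<bar> \<longleftrightarrow> i = j" if "i \<in> ?N" "j \<in> ?N" for i j
    using bij_betw_imp_inj_on[OF bij_betw_abs_signed_perm[OF pi]] that by (auto dest: inj_onD)
  let ?Q = "T \<union> prod.swap ` T"
  have Q: "(p, r) \<in> ?Q \<longleftrightarrow> p \<in> ?N \<and> r \<in> ?N \<and> p \<noteq> r \<and> \<pi> p + \<pi> r < 0" for p r
  proof -
    have "(p, r) \<in> ?Q \<longleftrightarrow> (p, r) \<in> T \<or> (r, p) \<in> T" by force
    \<comment> \<open>Distinct positions have distinct absolute values, so one entry of the pair dominates.\<close>
    also have "\<dots> \<longleftrightarrow> p \<in> ?N \<and> r \<in> ?N \<and> p \<noteq> r \<and> \<pi> p + \<pi> r < 0"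
      using abs_inj[of p r] unfolding Te by (smt (verit))
    finally show ?thesis .
  qed
  have split: "root_inversions n \<pi> = (PP \<union> ?m ` PP) \<union> ?l ` ?Q"
  proof (intro set_eqI)
    fix x :: "int \<times> int"
    obtain a b where x: "x = (a, b)" by (cases x)
    have m: "(a, b) \<in> ?m ` PP \<longleftrightarrow> (- b, - a) \<in> PP"
      by (auto simp: image_iff split: prod.splits) force
    have l: "(a, b) \<in> ?l ` ?Q \<longleftrightarrow> (- a, b) \<in> ?Q"
      by (auto simp: image_iff split: prod.splits) force+
    have "x \<in> (PP \<union> ?m ` PP) \<union> ?l ` ?Q
        \<longleftrightarrow> (a, b) \<in> PP \<or> (a, b) \<in> ?m ` PP \<or> (a, b) \<in> ?l ` ?Q"
      unfolding x by blast
    also have "\<dots> \<longleftrightarrow> (a, b) \<in> PP \<or> (- b, - a) \<in> PP \<or> (- a, b) \<in> ?Q"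
      by (simp only: m l)
    also have "\<dots> \<longleftrightarrow> x \<in> root_inversions n \<pi>"
      unfolding Q PPe x root_inversions_def using P(2)[of a] P(2)[of b] by auto
    finally show "x \<in> root_inversions n \<pi> \<longleftrightarrow> x \<in> (PP \<union> ?m ` PP) \<union> ?l ` ?Q" by simp
  qed
  have "card (root_inversions n \<pi>) = card (PP \<union> ?m ` PP) + card (?l ` ?Q)"
    unfolding split
  proof (rule card_Un_disjoint)
    show "(PP \<union> ?m ` PP) \<inter> ?l ` ?Q = {}"
    proof (intro equals0I)
      fix x assume "x \<in> (PP \<union> ?m ` PP) \<inter> ?l ` ?Q"
      then obtain y where y: "y \<in> ?Q" "x = ?l y" and x: "x \<in> PP \<union> ?m ` PP" by blast
      obtain p r where pr: "y = (p, r)" by (cases y)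
      have "1 \<le> p" "1 \<le> r" using y(1) unfolding pr Q by auto
      then show False using x y(2) pr by (auto simp: PPe)
    qed
  qed (use fin in auto)
  also have "card (PP \<union> ?m ` PP) = card PP + card (?m ` PP)"
    by (rule card_Un_disjoint) (use fin in \<open>auto simp: PPe\<close>)
  also have "card (?m ` PP) = card PP" by (rule card_image) (auto simp: inj_on_def)
  also have "card (?l ` ?Q) = card ?Q" by (rule card_image) (auto simp: inj_on_def)
  also have "card ?Q = card T + card (prod.swap ` T)"
    by (rule card_Un_disjoint) (use fin in \<open>auto simp: Te\<close>)
  also have "card (prod.swap ` T) = card T" by (rule card_image) auto
  also have "card T = (\<Sum>p\<in>Neg n \<pi>. card {r \<in> ?N. \<bar>\<pi> r\<bar> < - \<pi> p})"
    unfolding T_def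
  proof (rule card_SigmaI)
    show "finite (Neg n \<pi>)" by (rule finite_subset[of _ ?N]) (auto simp: Neg_def)
    show "\<forall>p\<in>Neg n \<pi>. finite {r \<in> ?N. \<bar>\<pi> r\<bar> < - \<pi> p}"
      by (intro ballI, rule finite_subset[of _ ?N]) auto
  qed
  also have "\<dots> = (\<Sum>p\<in>Neg n \<pi>. nat (- \<pi> p) - 1)"
  proof (rule sum.cong[OF refl])
    fix p assume p: "p \<in> Neg n \<pi>"
    let ?R = "{r \<in> ?N. \<bar>\<pi> r\<bar> < - \<pi> p}"
    have "- \<pi> p \<le> int n" using p signed_perm_pos[OF pi, of p] by (auto simp: Neg_def)
    moreover have "(\<lambda>r. \<bar>\<pi> r\<bar>) ` ?R = {u \<in> (\<lambda>r. \<bar>\<pi> r\<bar>) ` ?N. u < - \<pi> p}" by blast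
    moreover have "(\<lambda>r. \<bar>\<pi> r\<bar>) ` ?N = ?N"
      using bij_betw_abs_signed_perm[OF pi] by (rule bij_betw_imp_surj_on)
    ultimately have "(\<lambda>r. \<bar>\<pi> r\<bar>) ` ?R = {1..< - \<pi> p}" by auto
    moreover have "inj_on (\<lambda>r. \<bar>\<pi> r\<bar>) ?R" by (rule inj_onI) (simp add: abs_inj)
    ultimately have "card ?R = card {1..< - \<pi> p}" using card_image by fastforce
    then show "card ?R = nat (- \<pi> p) - 1" by simp
  qed
  also have "\<dots> = (\<Sum>k\<in>neg_values n \<pi>. k - 1)" by (rule sum_Neg_eq[OF pi])
  also have "card PP = inversions (rev_word \<pi> n)"
    unfolding PP_def by (rule inversions_rev_word[symmetric]) (simp add: inj_on_def P)
  finally show ?thesis by simp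
qed

text \<open>
  The reflections \<^term>\<open>simple_refl i\<close> permute the positions of the negative entries, whereas
  \<^const>\<open>simple_refl0\<close> changes the sign of two entries.
\<close>

lemma even_signed_perms_comp_generator:
  assumes pi: "\<pi> \<in> even_signed_perms n" and s: "s \<in> D_generators n"
  shows "\<pi> \<circ> s \<in> even_signed_perms n"
proof -
  have sp: "\<pi> \<in> signed_perms n" and ev: "even (neg n \<pi>)"
    using pi by (auto simp: even_signed_perms_def)
  note P = signed_permsD[OF sp]
  consider i where "i \<in> {1..int n - 1}" "s = simple_refl i" | "n \<ge> 2" "s = simple_refl0"
    using s by (auto simp: D_generators_def split: if_splits)
  then show ?thesis
  proof cases
    case 1
    have sn: "s \<in> signed_perms n" "s \<circ> s = id"
      using reflects_root_simple_refl[OF 1(1)] 1(2) by (auto simp: reflects_root_def)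
    have "s x \<in> {1..int n}" if "x \<in> {1..int n}" for x
      using 1 that by (auto simp: simple_refl_apply)
    then have "bij_betw s (Neg n (\<pi> \<circ> s)) (Neg n \<pi>)"
      using pointfree_idE[OF sn(2)] by (intro bij_betw_byWitness[where f' = s]) (auto simp: Neg_def)
    then have "neg n (\<pi> \<circ> s) = neg n \<pi>" unfolding neg_def by (rule bij_betw_same_card)
    then show ?thesis using ev signed_perms_comp[OF sp sn(1)] by (simp add: even_signed_perms_def)
  next
    case 2
    have sn: "s \<in> signed_perms n"
      using reflects_root_simple_refl0[OF 2(1)] 2(2) by (auto simp: reflects_root_def)
    let ?c = "\<lambda>\<rho> i :: int. if \<rho> i < (0 :: int) then {i} else {}"
    have neg: "neg n \<rho> = card (?c \<rho> 1) + card (?c \<rho> 2) + card {i \<in> {3..int n}. \<rho> i < 0}" for \<rho>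
    proof -
      have "Neg n \<rho> = (?c \<rho> 1 \<union> ?c \<rho> 2) \<union> {i \<in> {3..int n}. \<rho> i < 0}"
        using 2(1) unfolding Neg_def by (auto; smt (verit))
      moreover have "finite {i \<in> {3..int n}. \<rho> i < 0}"
        by (rule finite_subset[of _ "{3..int n}"]) auto
      then have "card ((?c \<rho> 1 \<union> ?c \<rho> 2) \<union> {i \<in> {3..int n}. \<rho> i < 0})
         = card (?c \<rho> 1 \<union> ?c \<rho> 2) + card {i \<in> {3..int n}. \<rho> i < 0}"
        by (intro card_Un_disjoint) auto
      moreover have "card (?c \<rho> 1 \<union> ?c \<rho> 2) = card (?c \<rho> 1) + card (?c \<rho> 2)"
        by (rule card_Un_disjoint) auto
      ultimately show ?thesis by (simp add: neg_def)
    qed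
    have "{i \<in> {3..int n}. (\<pi> \<circ> s) i < 0} = {i \<in> {3..int n}. \<pi> i < 0}"
      by (auto simp: 2(2) simple_refl0_apply)
    moreover have "\<pi> 1 \<noteq> 0" "\<pi> 2 \<noteq> 0" using signed_perm_pos(1)[OF sp] 2(1) by auto
    moreover have "(\<pi> \<circ> s) 1 = - \<pi> 2" "(\<pi> \<circ> s) 2 = - \<pi> 1"
      using P(2)[of 1] P(2)[of 2] by (auto simp: 2(2) simple_refl0_apply)
    ultimately have "even (neg n (\<pi> \<circ> s)) \<longleftrightarrow> even (neg n \<pi>)"
      unfolding neg by auto
    then show ?thesis using ev signed_perms_comp[OF sp sn] by (simp add: even_signed_perms_def)
  qed
qed

lemma D_generators_reflect:
  assumes "s \<in> D_generators n"
  shows "\<exists>a b. reflects_root n s (a, b)"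
  using assms reflects_root_simple_refl reflects_root_simple_refl0
  by (fastforce simp: D_generators_def split: if_splits)

lemma length_D_eq:
  assumes "\<pi> \<in> even_signed_perms n"
  shows "length_D n \<pi> = inversions (rev_word \<pi> n) + (\<Sum>k\<in>neg_values n \<pi>. k - 1)"
proof -
  have sp: "\<rho> \<in> signed_perms n" if "\<rho> \<in> even_signed_perms n" for \<rho>
    using that by (simp add: even_signed_perms_def)
  have "word_length (D_generators n) \<pi> = card (root_inversions n \<pi>) div 2"
  proof (rule word_length_eqI[where G = "even_signed_perms n"])
    have "Neg n id = {}" by (auto simp: Neg_def)
    then show "id \<in> even_signed_perms n"
      by (simp add: even_signed_perms_def signed_perms_def neg_def permutes_id)
    have "root_inversions n id = {}" by (auto simp: root_inversions_def)
    then show "card (root_inversions n id) div 2 = 0" by simp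
  next
    fix s assume "s \<in> D_generators n"
    then show "s \<circ> s = id" using D_generators_reflect by (fastforce simp: reflects_root_def)
  next
    fix \<rho> s assume \<rho>: "\<rho> \<in> even_signed_perms n" "s \<in> D_generators n"
    then obtain a b where r: "reflects_root n s (a, b)" using D_generators_reflect by blast
    then have "(a, b) \<in> root_inversions n s" by (simp add: reflects_root_def)
    then have "\<rho> a \<noteq> \<rho> b" by (simp add: root_inversions_def signed_permsD(4)[OF sp[OF \<rho>(1)]])
    then show "card (root_inversions n (\<rho> \<circ> s)) div 2 \<le> Suc (card (root_inversions n \<rho>) div 2)"
      using card_root_inversions_comp_descent[OF sp[OF \<rho>(1)] r] card_root_inversions_comp_ascent[OF sp[OF \<rho>(1)] r]
      by linarith
  next
    fix \<rho> assume \<rho>: "\<rho> \<in> even_signed_perms n" "\<rho> \<noteq> id"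
    then obtain s a b where "s \<in> D_generators n" and r: "reflects_root n s (a, b)" "\<rho> b < \<rho> a"
      using exists_descent by blast
    then show "\<exists>s\<in>D_generators n. Suc (card (root_inversions n (\<rho> \<circ> s)) div 2)
        = card (root_inversions n \<rho>) div 2"
      using card_root_inversions_comp_descent[OF sp[OF \<rho>(1)] r] by auto
  qed (use assms even_signed_perms_comp_generator in auto)
  then show ?thesis by (simp add: length_D_def card_root_inversions[OF sp[OF assms]])
qed

lemma dmaj_eq:
  assumes pi: "\<pi> \<in> signed_perms n"
  shows "dmaj n \<pi> = int (major (rev_word \<pi> n) + (\<Sum>k\<in>neg_values n \<pi>. k - 1))"
proof -
  have "- int (neg n \<pi>) - (\<Sum>i\<in>Neg n \<pi>. \<pi> i) = (\<Sum>i\<in>Neg n \<pi>. - \<pi> i - 1)"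
    by (simp add: neg_def sum_subtractf sum_negf)
  also have "\<dots> = (\<Sum>i\<in>Neg n \<pi>. int (nat (- \<pi> i) - 1))"
    by (rule sum.cong) (auto simp: Neg_def)
  also have "\<dots> = int (\<Sum>k\<in>neg_values n \<pi>. k - 1)"
    unfolding sum_Neg_eq[OF pi, symmetric] by simp
  finally show ?thesis by (simp add: dmaj_def major_rev_word)
qed

section \<open>Sorting signed permutations by their sets of values\<close>

definition signed_values :: "nat \<Rightarrow> nat set \<Rightarrow> int set" where
  "signed_values n A = (\<lambda>k. if k \<in> A then - int k else int k) ` {1..n}"

lemma finite_signed_values: "finite (signed_values n A)"
  and card_signed_values: "card (signed_values n A) = n"
proof -
  have "inj_on (\<lambda>k. if k \<in> A then - int k else int k) {1..n}"
    by (rule inj_onI) (auto split: if_splits)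
  then show "card (signed_values n A) = n"
    unfolding signed_values_def by (subst card_image) simp_all
qed (simp add: signed_values_def)

lemma image_signed_perm:
  assumes pi: "\<pi> \<in> signed_perms n"
  shows "\<pi> ` {1..int n} = signed_values n (neg_values n \<pi>)"
proof (rule card_subset_eq[OF finite_signed_values])
  show "\<pi> ` {1..int n} \<subseteq> signed_values n (neg_values n \<pi>)"
  proof (rule image_subsetI)
    fix i assume i: "i \<in> {1..int n}"
    define k where "k = nat \<bar>\<pi> i\<bar>"
    have k: "k \<in> {1..n}" "int k = \<bar>\<pi> i\<bar>" using signed_perm_pos[OF pi i] by (auto simp: k_def)
    have "k \<in> neg_values n \<pi> \<longleftrightarrow> \<pi> i < 0"
    proof
      assume "k \<in> neg_values n \<pi>"
      then obtain j where j: "j \<in> {1..int n}" "\<pi> j = - int k" by (auto simp: neg_values_def)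
      then have "j = i" using inj_onD[OF bij_betw_imp_inj_on[OF bij_betw_abs_signed_perm[OF pi]], of j i] i k by simp
      then show "\<pi> i < 0" using j k by simp
    next
      assume "\<pi> i < 0"
      then have "- int k = \<pi> i" using k by simp
      then show "k \<in> neg_values n \<pi>" using k(1) i by (simp add: neg_values_def)
    qed
    then show "\<pi> i \<in> signed_values n (neg_values n \<pi>)"
      unfolding signed_values_def using k by (intro image_eqI[of _ _ k]) auto
  qed
  have "inj_on \<pi> {1..int n}" by (simp add: inj_on_def signed_permsD[OF pi])
  then show "card (\<pi> ` {1..int n}) = card (signed_values n (neg_values n \<pi>))"
    by (simp add: card_image card_signed_values)
qed

text \<open>
  The signed permutations with a prescribed set \<open>A\<close> of negated values are all the rearrangements of
  one fixed set of integers. These are the cosets of the symmetric group in the group of signed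
  permutations.
\<close>

lemma bij_betw_rev_word:
  assumes A: "A \<subseteq> {1..n}"
  shows "bij_betw (\<lambda>\<pi>. rev_word \<pi> n) {\<pi> \<in> signed_perms n. neg_values n \<pi> = A}
           (permutations_of_set (signed_values n A))"
  unfolding bij_betw_def
proof (intro conjI equalityI subsetI)
  show "inj_on (\<lambda>\<pi>. rev_word \<pi> n) {\<pi> \<in> signed_perms n. neg_values n \<pi> = A}"
  proof (rule inj_onI, clarify)
    fix \<pi> \<rho> assume pi: "\<pi> \<in> signed_perms n" and rho: "\<rho> \<in> signed_perms n"
      and eq: "rev_word \<pi> n = rev_word \<rho> n"
    have pos: "\<pi> i = \<rho> i" if "i \<in> {1..int n}" for i
    proof -
      have j: "n - nat i < n" "int (n - (n - nat i)) = i" using that by auto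
      show ?thesis using nth_rev_word[OF j(1), of \<pi>] nth_rev_word[OF j(1), of \<rho>] unfolding j(2) eq by simp
    qed
    show "\<pi> = \<rho>"
    proof
      fix i
      consider "i \<in> {1..int n}" | "- i \<in> {1..int n}" | "i \<notin> letters n" by fastforce
      then show "\<pi> i = \<rho> i"
      proof cases
        case 2
        then show ?thesis using pos[of "- i"] signed_permsD(2)[OF pi] signed_permsD(2)[OF rho] by simp
      next
        case 3
        then show ?thesis using signed_permsD(1)[OF pi] signed_permsD(1)[OF rho] by (simp add: permutes_def)
      qed (rule pos)
    qed
  qed
next
  fix xs assume "xs \<in> (\<lambda>\<pi>. rev_word \<pi> n) ` {\<pi> \<in> signed_perms n. neg_values n \<pi> = A}"
  then obtain \<pi> where pi: "\<pi> \<in> signed_perms n" "neg_values n \<pi> = A" "xs = rev_word \<pi> n" by blast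
  have "distinct xs" unfolding pi by (rule distinct_rev_word) (simp add: inj_on_def signed_permsD[OF pi(1)])
  moreover have "set xs = signed_values n A" using pi image_signed_perm by (simp add: set_rev_word)
  ultimately show "xs \<in> permutations_of_set (signed_values n A)" by (simp add: permutations_of_set_def)
next
  fix xs assume "xs \<in> permutations_of_set (signed_values n A)"
  then have xs: "set xs = signed_values n A" "distinct xs" by (auto simp: permutations_of_set_def)
  then have len: "length xs = n" using distinct_card card_signed_values by metis
  \<comment> \<open>Position \<open>i\<close> of the signed permutation is entry \<open>n - i\<close> of the reversed word.\<close>
  define \<pi> where "\<pi> i = (if i \<in> {1..int n} then xs ! (n - nat i)
     else if - i \<in> {1..int n} then - (xs ! (n - nat (- i))) else i)" for i
  have mem: "\<pi> i \<in> signed_values n A" if "i \<in> {1..int n}" for i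
    using that len xs(1) by (auto simp: \<pi>_def intro!: nth_mem simp flip: xs(1))
  have "rev_word \<pi> n = xs"
    by (rule nth_equalityI) (auto simp: len nth_rev_word \<pi>_def nat_diff_distrib')
  moreover have "neg_values n \<pi> = A"
  proof -
    have "\<pi> ` {1..int n} = signed_values n A" using set_rev_word[of \<pi> n] \<open>rev_word \<pi> n = xs\<close> xs(1) by simp
    then show ?thesis using A by (fastforce simp: neg_values_def signed_values_def split: if_splits)
  qed
  moreover have "\<pi> \<in> signed_perms n"
  proof -
    have odd: "\<pi> (- i) = - \<pi> i" for i by (auto simp: \<pi>_def)
    have abs: "\<pi> \<bar>i\<bar> = (if i < 0 then - \<pi> i else \<pi> i)" for i using odd[of i] by auto
    have range: "\<bar>\<pi> i\<bar> \<in> {1..int n}" if "i \<in> {1..int n}" for i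
      using mem[OF that] by (auto simp: signed_values_def)
    have inj_pos: "i = j" if ij: "i \<in> {1..int n}" "j \<in> {1..int n}" and "\<bar>\<pi> i\<bar> = \<bar>\<pi> j\<bar>" for i j
    proof -
      have "\<pi> i = \<pi> j"
        using mem[OF ij(1)] mem[OF ij(2)] that(3) by (auto simp: signed_values_def split: if_splits)
      then have "xs ! (n - nat i) = xs ! (n - nat j)" using ij by (simp add: \<pi>_def)
      then have "n - nat i = n - nat j" using ij by (subst (asm) nth_eq_iff_index_eq[OF xs(2)]) (auto simp: len)
      then show ?thesis using ij by auto
    qed
    have "inj_on \<pi> (letters n)"
    proof (rule inj_onI)
      fix i j assume ij: "i \<in> letters n" "j \<in> letters n" "\<pi> i = \<pi> j"
      then have pos: "\<bar>i\<bar> \<in> {1..int n}" "\<bar>j\<bar> \<in> {1..int n}" by auto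
      have "\<bar>\<pi> \<bar>i\<bar>\<bar> = \<bar>\<pi> \<bar>j\<bar>\<bar>" using ij(3) by (simp add: abs)
      then have ab: "\<bar>i\<bar> = \<bar>j\<bar>" using inj_pos pos by blast
      show "i = j"
      proof (rule ccontr)
        assume "i \<noteq> j"
        then have "j = - i" using ab by (auto simp: abs_eq_iff)
        then have "\<pi> i = 0" using odd[of i] ij(3) by simp
        then have "\<pi> \<bar>i\<bar> = 0" by (simp only: abs) simp
        then show False using range[OF pos(1)] by simp
      qed
    qed
    moreover have "\<pi> ` letters n \<subseteq> letters n"
    proof (rule image_subsetI)
      fix i assume "i \<in> letters n"
      then have "\<bar>i\<bar> \<in> {1..int n}" by auto
      from range[OF this] show "\<pi> i \<in> letters n" by (auto simp: abs split: if_splits)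
    qed
    ultimately have "bij_betw \<pi> (letters n) (letters n)"
      by (simp add: bij_betw_def endo_inj_surj)
    then have "\<pi> permutes letters n" by (rule bij_imp_permutes) (auto simp: \<pi>_def)
    then show ?thesis using odd by (simp add: signed_perms_def)
  qed
  ultimately show "xs \<in> (\<lambda>\<pi>. rev_word \<pi> n) ` {\<pi> \<in> signed_perms n. neg_values n \<pi> = A}" by blast
qed

text \<open>
  On each coset the factor involving \<open>neg_values\<close> is constant, and the remaining sum depends only
  on the number of letters. The sum over the group is thus the product of a sum over the cosets,
  which are indexed by even subsets, with a sum over rearrangements.
\<close>

lemma sum_even_signed_perms_by_values:
  fixes F :: "int list \<Rightarrow> 'a::comm_ring_1" and x C :: 'a
  assumes n: "n \<ge> 1"
    and F: "\<And>V. finite V \<Longrightarrow> card V = n \<Longrightarrow> (\<Sum>xs\<in>permutations_of_set V. F xs) = C"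
  shows "(\<Sum>\<pi>\<in>even_signed_perms n. x ^ (\<Sum>k\<in>neg_values n \<pi>. k - 1) * F (rev_word \<pi> n))
       = (\<Prod>k=1..n-1. 1 + x ^ k) * C"
proof -
  let ?w = "\<lambda>A :: nat set. \<Sum>k\<in>A. k - 1"
  let ?E = "{A. A \<subseteq> {1..n} \<and> even (card A)}"
  have "finite (signed_perms n)"
    by (rule finite_subset[OF _ finite_permutations[of "letters n"]]) (auto simp: signed_perms_def)
  then have fin: "finite (even_signed_perms n)" by (simp add: even_signed_perms_def)
  have finE: "finite ?E" by (rule finite_subset[of _ "Pow {1..n}"]) auto
  have into: "neg_values n ` even_signed_perms n \<subseteq> ?E"
    by (auto simp: even_signed_perms_def neg_eq_card) (auto simp: neg_values_def)
  have fibre: "{\<pi> \<in> even_signed_perms n. neg_values n \<pi> = A} = {\<pi> \<in> signed_perms n. neg_values n \<pi> = A}"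
    if "A \<in> ?E" for A using that by (auto simp: even_signed_perms_def neg_eq_card)
  have "(\<Sum>\<pi>\<in>even_signed_perms n. x ^ ?w (neg_values n \<pi>) * F (rev_word \<pi> n))
     = (\<Sum>A\<in>?E. \<Sum>\<pi> | \<pi> \<in> even_signed_perms n \<and> neg_values n \<pi> = A. x ^ ?w (neg_values n \<pi>) * F (rev_word \<pi> n))"
    by (rule sum.group[OF fin finE into, symmetric])
  also have "\<dots> = (\<Sum>A\<in>?E. x ^ ?w A * C)"
  proof (rule sum.cong[OF refl])
    fix A assume A: "A \<in> ?E"
    have "(\<Sum>\<pi> | \<pi> \<in> even_signed_perms n \<and> neg_values n \<pi> = A. x ^ ?w (neg_values n \<pi>) * F (rev_word \<pi> n))
      = x ^ ?w A * (\<Sum>\<pi> | \<pi> \<in> signed_perms n \<and> neg_values n \<pi> = A. F (rev_word \<pi> n))"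
      unfolding fibre[OF A] sum_distrib_left by (rule sum.cong) auto
    also have "(\<Sum>\<pi> | \<pi> \<in> signed_perms n \<and> neg_values n \<pi> = A. F (rev_word \<pi> n))
      = (\<Sum>xs\<in>permutations_of_set (signed_values n A). F xs)"
      by (rule sum.reindex_bij_betw[OF bij_betw_rev_word]) (use A in simp)
    also have "\<dots> = C" by (rule F[OF finite_signed_values card_signed_values])
    finally show "(\<Sum>\<pi> | \<pi> \<in> even_signed_perms n \<and> neg_values n \<pi> = A.
        x ^ ?w (neg_values n \<pi>) * F (rev_word \<pi> n)) = x ^ ?w A * C" .
  qed
  also have "\<dots> = (\<Prod>k=1..n-1. 1 + x ^ k) * C"
    using sum_Pow_by_parity[where n = "n - 1" and e = True and x = x] n by (simp flip: sum_distrib_right)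
  finally show ?thesis .
qed

theorem theorem4p2:
  fixes q :: "'a::comm_ring_1" and n :: nat
  assumes "n \<ge> 1"
  shows "((\<Sum>\<pi>\<in>even_signed_perms n. (- 1) ^ length_D n \<pi> * q ^ length_D n \<pi>)
           = qnum n (- q) * (\<Prod>k=1..n-1. qnum (2 * k) (- q))) \<and>
         ((\<Sum>\<pi>\<in>even_signed_perms n. (- 1) ^ length_D n \<pi> * q ^ nat (dmaj n \<pi>))
           = qnum n ((- 1) ^ (n - 1) * q)
             * (\<Prod>k=1..n-1. qnum 2 ((- q) ^ k) * qnum k ((- 1) ^ (k - 1) * q)))"
proof (intro conjI)
  have top: "(\<Prod>k=1..n. g k) = g n * (\<Prod>k=1..n-1. g k)" for g :: "nat \<Rightarrow> 'a"
    using assms by (cases n) (simp_all add: mult.commute)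
  have minus: "(- 1) ^ k * q ^ k = (- q) ^ k" for k by (rule power_minus[symmetric])
  let ?w = "\<lambda>\<pi>. \<Sum>k\<in>neg_values n \<pi>. k - 1"
  have "(\<Sum>\<pi>\<in>even_signed_perms n. (- 1) ^ length_D n \<pi> * q ^ length_D n \<pi>)
      = (\<Sum>\<pi>\<in>even_signed_perms n. (- q) ^ ?w \<pi> * (- q) ^ inversions (rev_word \<pi> n))"
    unfolding minus by (rule sum.cong[OF refl]) (simp only: length_D_eq power_add mult.commute)
  also have "\<dots> = (\<Prod>k=1..n-1. 1 + (- q) ^ k) * (\<Prod>k=1..n. qnum k (- q))"
    by (rule sum_even_signed_perms_by_values[OF assms]) (simp add: sum_power_inversions)
  also have "\<dots> = qnum n (- q) * (\<Prod>k=1..n-1. qnum k (- q) * (1 + (- q) ^ k))"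
    unfolding top prod.distrib by (simp only: mult_ac)
  finally show "(\<Sum>\<pi>\<in>even_signed_perms n. (- 1) ^ length_D n \<pi> * q ^ length_D n \<pi>)
      = qnum n (- q) * (\<Prod>k=1..n-1. qnum (2 * k) (- q))"
    by (simp only: qnum_double)
  have "(\<Sum>\<pi>\<in>even_signed_perms n. (- 1) ^ length_D n \<pi> * q ^ nat (dmaj n \<pi>))
      = (\<Sum>\<pi>\<in>even_signed_perms n. (- q) ^ ?w \<pi>
          * ((- 1) ^ inversions (rev_word \<pi> n) * q ^ major (rev_word \<pi> n)))"
  proof (rule sum.cong[OF refl])
    fix \<pi> assume pi: "\<pi> \<in> even_signed_perms n"
    then have "nat (dmaj n \<pi>) = major (rev_word \<pi> n) + ?w \<pi>"
      by (simp only: even_signed_perms_def mem_Collect_eq dmaj_eq nat_int)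
    then show "(- 1) ^ length_D n \<pi> * q ^ nat (dmaj n \<pi>)
      = (- q) ^ ?w \<pi> * ((- 1) ^ inversions (rev_word \<pi> n) * q ^ major (rev_word \<pi> n))"
      by (simp only: length_D_eq[OF pi] power_add minus[symmetric] mult_ac)
  qed
  also have "\<dots> = (\<Prod>k=1..n-1. 1 + (- q) ^ k) * (\<Prod>k=1..n. qnum k ((- 1) ^ (k - 1) * q))"
    by (rule sum_even_signed_perms_by_values[OF assms]) (simp add: sum_signed_major)
  also have "\<dots> = qnum n ((- 1) ^ (n - 1) * q)
      * (\<Prod>k=1..n-1. qnum 2 ((- q) ^ k) * qnum k ((- 1) ^ (k - 1) * q))"
    unfolding top prod.distrib
    by (simp add: qnum_def numeral_2_eq_2 mult_ac)
  finally show "(\<Sum>\<pi>\<in>even_signed_perms n. (- 1) ^ length_D n \<pi> * q ^ nat (dmaj n \<pi>))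
      = qnum n ((- 1) ^ (n - 1) * q)
      * (\<Prod>k=1..n-1. qnum 2 ((- q) ^ k) * qnum k ((- 1) ^ (k - 1) * q))" .
qed

end
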